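(* Let $\mathcal{A}$ be a unital C*-algebra, let $0\leq \eta<1$, and suppose $(a_\alpha,\tau_\alpha)_{\alpha<\omega_1}$ is a UBABS+ of type $\eta$ in $\mathcal{A}$. Then $\mathcal{X}=\{a_\alpha:\alpha<\omega_1\}$ is an uncountable almost irredundant set in $\mathcal{A}$.
   Context: UBABS+ (uncountable positive bounded almost biorthogonal system) of type $\eta$: a bounded family $(a_\alpha,\tau_\alpha)_{\alpha<\omega_1}$ in $\mathcal{A}\times\mathcal{A}^*$ such that for every $\alpha<\omega_1$, $\tau_\alpha$ is a state (positive linear functional of norm one), $a_\alpha$ is a positive element with $0<a_\alpha\leq 1$, $\tau_\alpha(a_\alpha)=1$, and $|\tau_\alpha(a_\beta)|\leq\eta$ for all $\beta\neq\alpha$. Almost irredundant: a subset $\mathcal{X}\subseteq\mathcal{A}$ is almost irredundant if for every $a\in\mathcal{X}$, the element $a$ does not belong to the norm-closure of $$\Big\{\sum_{i=1}^n \lambda_i \prod_{j=1}^{n_i}a_{i,j}:\ a_{i,j}\in\mathcal{X}\setminus\{a\},\ \sum_{i=1}^n|\lambda_i|\leq 1\Big\},$$ where $n,n_i\geq 1$ and the $\lambda_i$ are complex scalars. *)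

theory Defs
  imports "HOL-Analysis.Analysis" "HOL-Library.Countable_Set"
begin

text \<open>
  Unital C*-algebras. The ambient classes provide a real Banach algebra with unit and
  \<open>norm 1 = 1\<close>; the complex scalar multiplication extends the real one. The zero
  algebra is thereby excluded; it has no states.
\<close>

class cstar_algebra_1 = real_normed_algebra_1 + banach +
  fixes scaleC :: "complex \<Rightarrow> 'a \<Rightarrow> 'a" (infixr "*\<^sub>C" 75)
    and star :: "'a \<Rightarrow> 'a"
  assumes scaleC_add_right: "c *\<^sub>C (x + y) = c *\<^sub>C x + c *\<^sub>C y"
    and scaleC_add_left: "(c + d) *\<^sub>C x = c *\<^sub>C x + d *\<^sub>C x"
    and scaleC_scaleC: "c *\<^sub>C (d *\<^sub>C x) = (c * d) *\<^sub>C x"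
    and scaleC_of_real: "complex_of_real r *\<^sub>C x = r *\<^sub>R x"
    and norm_scaleC: "norm (c *\<^sub>C x) = cmod c * norm x"
    and mult_scaleC_left: "(c *\<^sub>C x) * y = c *\<^sub>C (x * y)"
    and mult_scaleC_right: "x * (c *\<^sub>C y) = c *\<^sub>C (x * y)"
    and star_add: "star (x + y) = star x + star y"
    and star_scaleC: "star (c *\<^sub>C x) = cnj c *\<^sub>C star x"
    and star_mult: "star (x * y) = star y * star x"
    and star_star: "star (star x) = x"
    and cstar_identity: "norm (star x * x) = (norm x)\<^sup>2"

definition spectrum :: "'a::cstar_algebra_1 \<Rightarrow> complex set" where
  "spectrum a = {z. \<not> (\<exists>y. (a - z *\<^sub>C 1) * y = 1 \<and> y * (a - z *\<^sub>C 1) = 1)}"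

definition positive :: "'a::cstar_algebra_1 \<Rightarrow> bool" where
  "positive a \<longleftrightarrow> star a = a \<and> spectrum a \<subseteq> \<real>\<^sub>\<ge>\<^sub>0"

text \<open>The order of a C*-algebra; \<open>0 < a\<close> means \<open>0 \<le> a\<close> and \<open>a \<noteq> 0\<close>.\<close>

definition cstar_le :: "'a::cstar_algebra_1 \<Rightarrow> 'a \<Rightarrow> bool" where
  "cstar_le a b \<longleftrightarrow> positive (b - a)"

definition cstar_less :: "'a::cstar_algebra_1 \<Rightarrow> 'a \<Rightarrow> bool" where
  "cstar_less a b \<longleftrightarrow> cstar_le a b \<and> a \<noteq> b"

text \<open>
  The type \<^typ>\<open>'a \<Rightarrow>\<^sub>L complex\<close> consists of the bounded real-linear maps with the operator
  norm; the dual space is its subset of complex-homogeneous maps.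
\<close>

definition dual_space :: "('a::cstar_algebra_1 \<Rightarrow>\<^sub>L complex) set" where
  "dual_space = {t. \<forall>c x. blinfun_apply t (c *\<^sub>C x) = c * blinfun_apply t x}"

definition positive_functional :: "('a::cstar_algebra_1 \<Rightarrow>\<^sub>L complex) \<Rightarrow> bool" where
  "positive_functional t \<longleftrightarrow>
     t \<in> dual_space \<and> (\<forall>x. blinfun_apply t (star x * x) \<in> \<real>\<^sub>\<ge>\<^sub>0)"

definition state :: "('a::cstar_algebra_1 \<Rightarrow>\<^sub>L complex) \<Rightarrow> bool" where
  "state t \<longleftrightarrow> positive_functional t \<and> norm t = 1"

text \<open>
  The underlying set of the first uncountable cardinal, the successor cardinal of
  \<open>\<omega>\<close>: the indices \<open>\<alpha> < \<omega>\<^sub>1\<close> are its elements.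
\<close>

definition omega1 :: "nat set set" where
  "omega1 = Field (cardSuc natLeq)"

definition UBABS_plus ::
  "real \<Rightarrow> (nat set \<Rightarrow> 'a::cstar_algebra_1) \<Rightarrow> (nat set \<Rightarrow> 'a \<Rightarrow>\<^sub>L complex) \<Rightarrow> bool" where
  "UBABS_plus \<eta> a t \<longleftrightarrow>
     bounded ((\<lambda>\<alpha>. (a \<alpha>, t \<alpha>)) ` omega1) \<and>
     (\<forall>\<alpha>\<in>omega1.
        state (t \<alpha>) \<and>
        cstar_less 0 (a \<alpha>) \<and> cstar_le (a \<alpha>) 1 \<and>
        blinfun_apply (t \<alpha>) (a \<alpha>) = 1 \<and>
        (\<forall>\<beta>\<in>omega1. \<beta> \<noteq> \<alpha> \<longrightarrow> cmod (blinfun_apply (t \<alpha>) (a \<beta>)) \<le> \<eta>))"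

text \<open>The list \<open>w i\<close> holds the factors of the \<open>i\<close>-th product, in order.\<close>

definition almost_irredundant :: "'a::cstar_algebra_1 set \<Rightarrow> bool" where
  "almost_irredundant X \<longleftrightarrow>
     (\<forall>a\<in>X. a \<notin> closure
        {(\<Sum>i<n. l i *\<^sub>C prod_list (w i)) | (n::nat) (l::nat \<Rightarrow> complex) (w::nat \<Rightarrow> 'a list).
           n \<ge> 1 \<and> (\<forall>i<n. w i \<noteq> [] \<and> set (w i) \<subseteq> X - {a}) \<and> (\<Sum>i<n. cmod (l i)) \<le> 1})"

end

theory Submission
  imports Defs
begin

text \<open>
  Let \<open>t\<close> be the state belonging to \<open>a \<alpha>\<close>. It takes the value 1 at \<open>a \<alpha>\<close>, whereas on every
  product of other members of the family its absolute value is at most \<open>sqrt \<eta>\<close>. This bound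
  passes to linear combinations with coefficient sum at most 1 and, by continuity, to the
  closure; since \<open>sqrt \<eta> < 1\<close>, the element \<open>a \<alpha>\<close> lies outside.

  The bound for a product \<open>b * y\<close> with first factor \<open>b\<close> (lemma \<open>state_prod_list_le\<close>) comes from
  the Cauchy-Schwarz inequality \<open>\<bar>t (b * y)\<bar>\<^sup>2 \<le> t (b\<^sup>2) * t (y\<^sup>* * y)\<close> together with
  \<open>\<parallel>y\<parallel> \<le> 1\<close> and \<open>t (b\<^sup>2) \<le> t b \<le> \<eta>\<close>.

  Both \<open>\<parallel>b\<parallel> \<le> 1\<close> and \<open>t (b\<^sup>2) \<le> t b\<close> follow from the single estimate \<open>\<parallel>b - 1/2\<parallel> \<le> 1/2\<close>
  for \<open>0 \<le> b \<le> 1\<close> (\<open>norm_positive_contraction_minus_half\<close>). The order is defined through the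
  spectrum, so this estimate requires that the norm of a self-adjoint element be controlled by
  its spectrum (\<open>spectrum_reaches_norm\<close>). That is the spectral radius formula in the special
  case where the norms of the powers \<open>h ^ (2 ^ m)\<close> are known exactly; in place of
  vector-valued holomorphic functions, the proof averages the resolvent over roots of unity
  and uses its uniform continuity on the closed disc.

  The set is uncountable because \<open>\<alpha> \<mapsto> a \<alpha>\<close> is injective: the state belonging to \<open>a \<alpha>\<close>
  separates \<open>a \<alpha>\<close> from all other members.
\<close>

section \<open>Scalars and the involution\<close>

lemma scaleC_zero_right: "c *\<^sub>C (0::'a::cstar_algebra_1) = 0"
  using scaleC_add_right[of c 0 "0::'a"] by simp

lemma scaleC_minus_right: "c *\<^sub>C (- x::'a::cstar_algebra_1) = - (c *\<^sub>C x)"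
  using scaleC_add_right[of c x "- x"] by (simp add: scaleC_zero_right eq_neg_iff_add_eq_0 add.commute)

lemma scaleC_diff_right: "c *\<^sub>C (x - y::'a::cstar_algebra_1) = c *\<^sub>C x - c *\<^sub>C y"
  using scaleC_add_right[of c x "- y"] by (simp add: scaleC_minus_right)

lemma scaleC_diff_left: "(c - d) *\<^sub>C (x::'a::cstar_algebra_1) = c *\<^sub>C x - d *\<^sub>C x"
  using scaleC_add_left[of "c - d" d x] by simp

lemma scaleC_zero_left: "0 *\<^sub>C (x::'a::cstar_algebra_1) = 0"
  using scaleC_of_real[of 0 x] by simp

lemma scaleC_minus_left: "(- c) *\<^sub>C (x::'a::cstar_algebra_1) = - (c *\<^sub>C x)"
  using scaleC_diff_left[of 0 c x] by (simp add: scaleC_zero_left)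

lemma scaleC_one: "1 *\<^sub>C (x::'a::cstar_algebra_1) = x"
  using scaleC_of_real[of 1 x] by simp

lemma star_one: "star 1 = (1::'a::cstar_algebra_1)"
  using star_mult[of "star 1" "1::'a"] by (simp add: star_star)

lemma star_scaleR: "star (r *\<^sub>R x) = r *\<^sub>R star (x::'a::cstar_algebra_1)"
  using star_scaleC[of "complex_of_real r" x] by (simp add: scaleC_of_real)

lemma star_minus: "star (- x) = - star (x::'a::cstar_algebra_1)"
  using star_scaleR[of "-1" x] by simp

lemma star_diff: "star (x - y) = star x - star (y::'a::cstar_algebra_1)"
  using star_add[of x "- y"] by (simp add: star_minus)

lemma star_power: "star (x ^ n) = star (x::'a::cstar_algebra_1) ^ n"
  by (induction n) (simp_all add: star_one star_mult power_commutes)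

section \<open>The norm of a self-adjoint element and its spectrum\<close>

lemma norm_self_adjoint_power:
  fixes x :: "'a::cstar_algebra_1"
  assumes "star x = x"
  shows "norm (x ^ (2 ^ m)) = norm x ^ (2 ^ m)"
proof (induction m)
  case (Suc m)
  have "star (x ^ (2 ^ m)) = x ^ (2 ^ m)"
    using assms by (simp add: star_power)
  then have "norm (x ^ (2 ^ m) * x ^ (2 ^ m)) = (norm (x ^ (2 ^ m)))\<^sup>2"
    using cstar_identity[of "x ^ (2 ^ m)"] by simp
  then show ?case
    using Suc by (simp add: power_add[symmetric] power_mult[symmetric] mult_2 mult.commute
        flip: power_mult power_add)
qed simp

definition is_inverse :: "'a::cstar_algebra_1 \<Rightarrow> 'a \<Rightarrow> bool" where
  "is_inverse x y \<longleftrightarrow> x * y = 1 \<and> y * x = 1"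

text \<open>
  The resolvent identity \<open>g z - g w = (z - w) g z k g w\<close> bounds \<open>g z\<close> by twice the norm
  of \<open>g w\<close> once \<open>z\<close> is close to \<open>w\<close>, and then bounds the difference linearly.
\<close>

lemma continuous_on_resolvent:
  fixes k :: "'a::cstar_algebra_1"
  assumes g: "\<And>z. z \<in> S \<Longrightarrow> is_inverse (1 - z *\<^sub>C k) (g z)"
  shows "continuous_on S g"
  unfolding continuous_on_iff
proof (intro ballI allI impI)
  fix w and e :: real
  assume w: "w \<in> S" and e: "e > 0"
  define M where "M = norm k * norm (g w)"
  have M0: "M \<ge> 0" by (simp add: M_def)
  define d where "d = min (1 / (2 * (M + 1))) (e / (2 * M * norm (g w) + 1))"
  have pos: "0 < 2 * M * norm (g w) + 1" using M0 by (simp add: add_nonneg_pos)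
  have d: "d > 0" using M0 e pos by (simp add: d_def)
  show "\<exists>d>0. \<forall>z\<in>S. dist z w < d \<longrightarrow> dist (g z) (g w) < e"
  proof (intro exI[of _ d] conjI ballI impI d)
    fix z assume z: "z \<in> S" and zd: "dist z w < d"
    have "g z * ((1 - w *\<^sub>C k) - (1 - z *\<^sub>C k)) * g w = (g z * (1 - w *\<^sub>C k)) * g w - (g z * (1 - z *\<^sub>C k)) * g w"
      by (simp add: algebra_simps)
    also have "\<dots> = g z - g w"
      using g[OF z] g[OF w] by (simp add: is_inverse_def mult.assoc)
    finally have "g z - g w = g z * ((z - w) *\<^sub>C k) * g w"
      by (simp add: scaleC_diff_left)
    then have "norm (g z - g w) \<le> norm (g z * ((z - w) *\<^sub>C k)) * norm (g w)"
      by (simp add: norm_mult_ineq)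
    also have "\<dots> \<le> norm (g z) * (cmod (z - w) * norm k) * norm (g w)"
      using norm_mult_ineq[of "g z" "(z - w) *\<^sub>C k"]
      by (intro mult_right_mono) (simp_all add: norm_scaleC)
    finally have le: "norm (g z - g w) \<le> norm (g z) * (cmod (z - w) * M)"
      by (simp add: M_def mult_ac)
    have "cmod (z - w) * M \<le> 1 / (2 * (M + 1)) * M"
      using zd M0 by (intro mult_right_mono) (auto simp: d_def dist_norm)
    also have "\<dots> \<le> 1 / 2" using M0 by (simp add: field_simps)
    finally have half: "cmod (z - w) * M \<le> 1 / 2" .
    have "norm (g z - g w) \<le> norm (g z) * (1 / 2)"
      using le mult_left_mono[OF half norm_ge_zero, of "g z"] by linarith
    then have two: "norm (g z) \<le> 2 * norm (g w)"
      using norm_triangle_sub[of "g z" "g w"] by linarith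
    have "norm (g z - g w) \<le> 2 * norm (g w) * (cmod (z - w) * M)"
      using le mult_right_mono[OF two, of "cmod (z - w) * M"] M0 by simp
    also have "\<dots> = cmod (z - w) * (2 * M * norm (g w))" by simp
    also have "\<dots> \<le> cmod (z - w) * (2 * M * norm (g w) + 1)"
      by (intro mult_left_mono) auto
    also have "\<dots> < e"
      using zd pos by (simp add: d_def dist_norm field_simps)
    finally show "dist (g z) (g w) < e" by (simp add: dist_norm)
  qed
qed

lemma is_inverse_one_minus_square:
  fixes x :: "'a::cstar_algebra_1"
  assumes "is_inverse (1 - x) u" and "is_inverse (1 + x) v"
  shows "is_inverse (1 - x * x) ((1/2) *\<^sub>R (u + v))"
proof -
  have f1: "1 - x * x = (1 + x) * (1 - x)" and f2: "1 - x * x = (1 - x) * (1 + x)"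
    by (simp_all add: algebra_simps)
  have "(1 - x * x) * u = 1 + x" 
    using assms by (simp add: f1 is_inverse_def mult.assoc)
  moreover have "(1 - x * x) * v = 1 - x"
    using assms by (simp add: f2 is_inverse_def mult.assoc)
  moreover have "u * (1 - x * x) = 1 + x"
    using assms by (simp add: f2 is_inverse_def flip: mult.assoc)
  moreover have "v * (1 - x * x) = 1 - x"
    using assms by (simp add: f1 is_inverse_def flip: mult.assoc)
  moreover have "(1/2::real) *\<^sub>R ((1 + x) + (1 - x)) = 1"
    by (simp flip: scaleR_2)
  ultimately show ?thesis
    by (simp add: is_inverse_def distrib_left distrib_right)
qed

text \<open>
  This is the averaging of the resolvent over the \<open>2 ^ m\<close>-th roots of unity, one square root
  at a time: averaging keeps the bound \<open>e\<close> while it replaces \<open>k\<close> by \<open>k ^ (2 ^ m)\<close> and \<open>r\<close> by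
  \<open>r ^ (2 ^ m)\<close>.
\<close>

lemma resolvent_average:
  fixes k :: "'a::cstar_algebra_1"
  assumes "\<And>z. cmod z = 1 \<Longrightarrow>
      \<exists>u v. is_inverse (1 - z *\<^sub>C k) u \<and> is_inverse (1 - (of_real r * z) *\<^sub>C k) v \<and> norm (u - v) \<le> e"
    and "cmod z = 1"
  shows "\<exists>u v. is_inverse (1 - z *\<^sub>C k ^ (2 ^ m)) u \<and>
      is_inverse (1 - (of_real (r ^ (2 ^ m)) * z) *\<^sub>C k ^ (2 ^ m)) v \<and> norm (u - v) \<le> e"
  using assms(2)
proof (induction m arbitrary: z)
  case 0
  then show ?case using assms(1) by simp
next
  case (Suc m)
  define p where "p = k ^ (2 ^ m)"
  define s where "s = complex_of_real (r ^ (2 ^ m))"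
  define y where "y = csqrt z"
  have y2: "y * y = z" using power2_csqrt[of z] by (simp add: y_def power2_eq_square)
  have "cmod y = 1" "cmod (- y) = 1" using Suc.prems by (simp_all add: y_def)
  from Suc.IH[OF this(1)] Suc.IH[OF this(2)] obtain u v u' v' where
    u: "is_inverse (1 - y *\<^sub>C p) u" "is_inverse (1 - (- y) *\<^sub>C p) u'" and
    v: "is_inverse (1 - (s * y) *\<^sub>C p) v" "is_inverse (1 - (s * (- y)) *\<^sub>C p) v'" and
    le: "norm (u - v) \<le> e" "norm (u' - v') \<le> e"
    unfolding p_def s_def by blast
  have pp: "k ^ (2 ^ Suc m) = p * p"
    by (simp add: p_def mult_2 flip: power_add)
  have ss: "complex_of_real (r ^ (2 ^ Suc m)) = s * s"
    by (simp add: s_def mult_2 flip: power_add)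
  have "is_inverse (1 - (y *\<^sub>C p) * (y *\<^sub>C p)) ((1/2) *\<^sub>R (u + u'))"
    using u by (intro is_inverse_one_minus_square) (simp_all add: scaleC_minus_left)
  then have 1: "is_inverse (1 - z *\<^sub>C (p * p)) ((1/2) *\<^sub>R (u + u'))"
    by (simp add: mult_scaleC_left mult_scaleC_right scaleC_scaleC y2)
  have "is_inverse (1 - ((s * y) *\<^sub>C p) * ((s * y) *\<^sub>C p)) ((1/2) *\<^sub>R (v + v'))"
    using v by (intro is_inverse_one_minus_square) (simp_all add: scaleC_minus_left)
  moreover have "(s * y) * (s * y) = s * s * z" by (simp add: y2[symmetric])
  ultimately have 2: "is_inverse (1 - (s * s * z) *\<^sub>C (p * p)) ((1/2) *\<^sub>R (v + v'))"
    by (simp only: mult_scaleC_left mult_scaleC_right scaleC_scaleC)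
  have "(1/2) *\<^sub>R (u + u') - (1/2) *\<^sub>R (v + v') = (1/2) *\<^sub>R ((u - v) + (u' - v'))"
    by (simp add: algebra_simps)
  also have "norm \<dots> \<le> e"
    using norm_triangle_ineq[of "u - v" "u' - v'"] le by simp
  finally have 3: "norm ((1/2) *\<^sub>R (u + u') - (1/2) *\<^sub>R (v + v')) \<le> e" .
  show ?case unfolding pp ss using 1 2 3 by blast
qed

text \<open>
  The closed disc is compact, so the resolvent is uniformly continuous on it, and by averaging
  the inverses of \<open>1 - k ^ n\<close> and \<open>1 - r ^ n k ^ n\<close> are close for all \<open>n = 2 ^ m\<close>, as soon as
  \<open>r < 1\<close> is close to 1. The second inverse tends to 1, since \<open>norm (k ^ n) \<le> 1\<close>. So
  the first one is eventually near 1, which is impossible when \<open>norm (k ^ n) = 1\<close>.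
\<close>

lemma norm_one_self_adjoint_not_all_invertible:
  fixes k :: "'a::cstar_algebra_1"
  assumes sa: "star k = k" and k1: "norm k = 1"
  shows "\<exists>z. cmod z \<le> 1 \<and> (\<nexists>y. is_inverse (1 - z *\<^sub>C k) y)"
proof (rule ccontr)
  assume "\<not> ?thesis"
  then have "\<forall>z\<in>cball 0 1. \<exists>y. is_inverse (1 - z *\<^sub>C k) y" by auto
  then obtain g where g: "\<And>z. z \<in> cball 0 1 \<Longrightarrow> is_inverse (1 - z *\<^sub>C k) (g z)" by metis
  have "uniformly_continuous_on (cball 0 1) g"
    by (intro compact_uniformly_continuous continuous_on_resolvent[OF g] compact_cball)
  then obtain d where d: "d > 0" and
    gd: "\<And>z w. z \<in> cball 0 1 \<Longrightarrow> w \<in> cball 0 1 \<Longrightarrow> dist w z < d \<Longrightarrow> dist (g w) (g z) < 1/6"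
    unfolding uniformly_continuous_on_def
    by (metis zero_less_divide_1_iff zero_less_numeral)
  define r where "r = max 0 (1 - d / 2)"
  have r: "0 \<le> r" "r < 1" "1 - r < d" using d by (auto simp: r_def)
  have base: "\<exists>u v. is_inverse (1 - z *\<^sub>C k) u \<and> is_inverse (1 - (of_real r * z) *\<^sub>C k) v
      \<and> norm (u - v) \<le> 1/6" if z: "cmod z = 1" for z
  proof -
    have in1: "z \<in> cball 0 1" and in2: "of_real r * z \<in> cball 0 1"
      using z r by (simp_all add: norm_mult)
    then have inv: "is_inverse (1 - z *\<^sub>C k) (g z)"
      "is_inverse (1 - (of_real r * z) *\<^sub>C k) (g (of_real r * z))" using g by auto
    have "z - of_real r * z = of_real (1 - r) * z" by (simp add: algebra_simps)
    then have "dist z (of_real r * z) < d"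
      using z r by (simp only: dist_norm norm_mult norm_of_real) simp
    from gd[OF in2 in1 this] have "norm (g z - g (of_real r * z)) \<le> 1/6"
      by (simp add: dist_norm)
    then show ?thesis using inv by blast
  qed
  \<comment> \<open>With \<open>r ^ n \<le> 1/7\<close> the inverse of \<open>1 - r ^ n k ^ n\<close> is within \<open>1/6\<close> of 1.\<close>
  obtain m0 where m0: "r ^ m0 < 1/7"
    using real_arch_pow_inv[of "1/7" r] r by auto
  define n where "n = (2::nat) ^ m0"
  have "m0 \<le> n" unfolding n_def using less_exp[of m0] by simp
  then have rn: "r ^ n < 1/7" using power_decreasing[of m0 n r] m0 r by simp
  define q where "q = k ^ n"
  have q1: "norm q = 1" using norm_self_adjoint_power[OF sa, of m0] k1 by (simp add: q_def n_def)
  obtain u v where u: "is_inverse (1 - q) u"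
    and v: "is_inverse (1 - (r ^ n) *\<^sub>R q) v" and uv: "norm (u - v) \<le> 1/6"
    using resolvent_average[of k r "1/6" 1 m0, OF base]
    by (auto simp: q_def n_def scaleC_one scaleC_of_real simp del: of_real_power)
  have "v - 1 = v * ((r ^ n) *\<^sub>R q)"
    using v by (simp add: is_inverse_def right_diff_distrib) (metis diff_add_cancel add_diff_cancel_left')
  then have "norm (v - 1) \<le> norm v * (r ^ n)"
    using norm_mult_ineq[of v "(r ^ n) *\<^sub>R q"] q1 r by simp
  also have "\<dots> \<le> norm v * (1/7)" using rn by (intro mult_left_mono) auto
  finally have "norm (v - 1) \<le> norm v / 7" by simp
  moreover have "norm v \<le> norm (v - 1) + 1" using norm_triangle_sub[of v 1] by simp
  ultimately have "norm (v - 1) \<le> 1/6" by linarith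
  then have u1: "norm (u - 1) \<le> 1/3"
    using norm_triangle_ineq[of "u - v" "v - 1"] uv by simp
  have "q = (1 - q) * (u - 1)"
    using u by (simp add: is_inverse_def right_diff_distrib)
  then have "norm q \<le> norm (1 - q) * norm (u - 1)" by (metis norm_mult_ineq)
  also have "\<dots> \<le> 2 * (1/3)"
    using norm_triangle_ineq4[of 1 q] q1 u1 by (intro mult_mono) auto
  finally show False using q1 by simp
qed

lemma spectrum_reaches_norm:
  fixes h :: "'a::cstar_algebra_1"
  assumes "star h = h"
  shows "\<exists>z\<in>spectrum h. norm h \<le> cmod z"
proof (cases "h = 0")
  case True
  then have "0 \<in> spectrum h" by (simp add: spectrum_def scaleC_zero_left)
  then show ?thesis using True by auto
next
  case False
  define k where "k = (1 / norm h) *\<^sub>R h"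
  have "star k = k" "norm k = 1" using assms False by (simp_all add: k_def star_scaleR)
  then obtain z where z: "cmod z \<le> 1" "\<nexists>y. is_inverse (1 - z *\<^sub>C k) y"
    using norm_one_self_adjoint_not_all_invertible by blast
  have z0: "z \<noteq> 0"
    using z(2) by (auto simp: is_inverse_def scaleC_zero_left)
  define w where "w = of_real (norm h) / z"
  have w0: "w \<noteq> 0" using z0 False by (simp add: w_def)
  have "z *\<^sub>C k = (z * of_real (1 / norm h)) *\<^sub>C h"
    by (simp add: k_def scaleC_scaleC flip: scaleC_of_real)
  then have zk: "z *\<^sub>C k = (1 / w) *\<^sub>C h" by (simp add: w_def)
  \<comment> \<open>\<open>h - w\<close> is a nonzero multiple of \<open>1 - z k\<close>.\<close>
  have hw: "1 - z *\<^sub>C k = (- 1 / w) *\<^sub>C (h - w *\<^sub>C 1)"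
    using w0 by (simp add: zk scaleC_diff_right scaleC_minus_left scaleC_scaleC scaleC_one)
  have "w \<in> spectrum h"
    unfolding spectrum_def
  proof (clarify)
    fix y assume "(h - w *\<^sub>C 1) * y = 1" "y * (h - w *\<^sub>C 1) = 1"
    then have "is_inverse (1 - z *\<^sub>C k) ((- w) *\<^sub>C y)"
      unfolding hw is_inverse_def using w0
      by (simp add: mult_scaleC_left mult_scaleC_right scaleC_scaleC scaleC_one)
    then show False using z(2) by blast
  qed
  moreover have "norm h \<le> cmod w"
    using z z0 by (simp add: w_def norm_divide field_simps mult_left_le)
  ultimately show ?thesis by blast
qed

text \<open>
  The centre 1/2 turns the two one-sided conditions on the spectrum of \<open>b\<close> into
  a single norm bound.
\<close>

lemma norm_positive_contraction_minus_half:
  fixes b :: "'a::cstar_algebra_1"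
  assumes "cstar_le 0 b" and "cstar_le b 1"
  shows "norm (b - (1/2) *\<^sub>R 1) \<le> 1/2"
proof -
  have sa: "star b = b" and s0: "spectrum b \<subseteq> \<real>\<^sub>\<ge>\<^sub>0" and s1: "spectrum (1 - b) \<subseteq> \<real>\<^sub>\<ge>\<^sub>0"
    using assms by (simp_all add: cstar_le_def positive_def)
  define h where "h = b - (1/2) *\<^sub>R (1::'a)"
  have "star h = h" by (simp add: h_def star_diff star_scaleR star_one sa)
  then obtain z where z: "z \<in> spectrum h" and le: "norm h \<le> cmod z"
    using spectrum_reaches_norm by blast
  have half: "(1/2) *\<^sub>C (1::'a) = (1/2) *\<^sub>R 1"
    using scaleC_of_real[of "1/2" "1::'a"] by simp
  have shift: "b - (z + 1/2) *\<^sub>C 1 = h - z *\<^sub>C 1"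
    by (simp add: h_def scaleC_add_left half)
  have "z + 1/2 \<in> spectrum b"
    using z by (simp add: spectrum_def shift)
  then have 1: "z + 1/2 \<in> \<real>\<^sub>\<ge>\<^sub>0" using s0 by blast
  have "1 - (1/2) *\<^sub>R (1::'a) = (1 - 1/2) *\<^sub>R 1" by (simp only: scaleR_diff_left scaleR_one)
  then have "1 - (1/2) *\<^sub>R (1::'a) = (1/2) *\<^sub>R 1" by simp
  then have reflect: "1 - b - (1/2 - z) *\<^sub>C 1 = - (h - z *\<^sub>C 1)"
    by (simp add: h_def scaleC_diff_left half algebra_simps)
  have "1/2 - z \<in> spectrum (1 - b)"
    unfolding spectrum_def mem_Collect_eq reflect
  proof
    assume "\<exists>y. - (h - z *\<^sub>C 1) * y = 1 \<and> y * - (h - z *\<^sub>C 1) = 1"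
    then obtain y where "(h - z *\<^sub>C 1) * (- y) = 1" "(- y) * (h - z *\<^sub>C 1) = 1"
      by (auto simp only: mult_minus_left mult_minus_right)
    then show False using z unfolding spectrum_def by blast
  qed
  then have 2: "1/2 - z \<in> \<real>\<^sub>\<ge>\<^sub>0" using s1 by blast
  have "Im z = 0" "\<bar>Re z\<bar> \<le> 1/2"
    using 1 2 by (auto simp: complex_nonneg_Reals_iff)
  then have "cmod z \<le> 1/2" by (simp add: cmod_def)
  with le show ?thesis by (simp add: h_def)
qed

lemma norm_positive_contraction:
  fixes b :: "'a::cstar_algebra_1"
  assumes "cstar_le 0 b" and "cstar_le b 1"
  shows "norm b \<le> 1"
  using norm_positive_contraction_minus_half[OF assms]
    norm_triangle_ineq[of "b - (1/2) *\<^sub>R 1" "(1/2) *\<^sub>R 1"] by simp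

section \<open>Positive functionals and states\<close>

lemma positive_functional_Cauchy_Schwarz:
  fixes x y :: "'a::cstar_algebra_1"
  assumes t: "positive_functional t"
  shows "(cmod (t (star x * y)))\<^sup>2 \<le> Re (t (star x * x)) * Re (t (star y * y))"
proof -
  have hom: "t (c *\<^sub>C u) = c * t u" for c u
    using t by (simp add: positive_functional_def dual_space_def)
  have pos: "Im (t (star u * u)) = 0 \<and> Re (t (star u * u)) \<ge> 0" for u
    using t by (auto simp: positive_functional_def complex_nonneg_Reals_iff)
  define A B T T' where "A = t (star x * x)" and "B = t (star y * y)"
    and "T = t (star x * y)" and "T' = t (star y * x)"
  have expand: "t (star (x + c *\<^sub>C y) * (x + c *\<^sub>C y)) = A + c * T + cnj c * T' + cnj c * c * B" for c
    by (simp add: star_add star_scaleC distrib_left distrib_right mult_scaleC_left mult_scaleC_right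
        scaleC_scaleC blinfun.add_right hom A_def B_def T_def T'_def mult.commute mult.assoc)
  have A: "Im A = 0" and B: "Im B = 0" "Re B \<ge> 0" using pos by (simp_all add: A_def B_def)
  have "Im T + Im T' = 0"
    using pos[of "x + 1 *\<^sub>C y"] unfolding expand by (simp add: A B)
  moreover have "Re T - Re T' = 0"
    using pos[of "x + \<i> *\<^sub>C y"] unfolding expand by (simp add: A B)
  ultimately have T': "T' = cnj T" by (simp add: complex_eq_iff)
  \<comment> \<open>The phase \<open>c = - s * cnj T\<close> makes the linear term real; \<open>s = 1 / Re B\<close> minimises the quadratic.\<close>
  have quad: "0 \<le> Re A - 2 * s * (cmod T)\<^sup>2 + s\<^sup>2 * (cmod T)\<^sup>2 * Re B" for s
  proof -
    have "0 \<le> Re (A + c * T + cnj c * T' + cnj c * c * B)"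
      if "c = - of_real s * cnj T" for c
      using pos[of "x + c *\<^sub>C y"] unfolding expand by simp
    from this[OF refl] show ?thesis
      unfolding T' cmod_power2 by (simp add: B power2_eq_square algebra_simps)
  qed
  show ?thesis
  proof (cases "Re B = 0")
    case True
    have "cmod T = 0"
    proof (rule ccontr)
      assume "cmod T \<noteq> 0"
      then show False
        using quad[of "(Re A + 1) / (2 * (cmod T)\<^sup>2)"] True by (simp add: field_simps)
    qed
    then show ?thesis using True by (simp add: T_def B_def)
  next
    case False
    then have "Re B > 0" using B by simp
    then have "(cmod T)\<^sup>2 \<le> Re A * Re B"
      using quad[of "1 / Re B"] by (simp add: field_simps power2_eq_square)
    then show ?thesis by (simp add: A_def B_def T_def)
  qed
qed

lemma state_norm_le:
  assumes "state t"
  shows "cmod (t x) \<le> norm x"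
  using assms norm_blinfun[of t x] by (simp add: state_def)

lemma state_mult_le:
  fixes x y :: "'a::cstar_algebra_1"
  assumes t: "state t"
  shows "(cmod (t (star x * y)))\<^sup>2 \<le> Re (t (star x * x)) * (norm y)\<^sup>2"
proof -
  have p: "positive_functional t" using t by (simp add: state_def)
  have "Re (t (star y * y)) \<le> (norm y)\<^sup>2"
    using state_norm_le[OF t, of "star y * y"] complex_Re_le_cmod[of "t (star y * y)"]
    by (simp add: cstar_identity)
  moreover have "0 \<le> Re (t (star x * x))"
    using p by (simp add: positive_functional_def complex_nonneg_Reals_iff)
  ultimately show ?thesis
    using positive_functional_Cauchy_Schwarz[OF p, of x y]
    by (meson mult_left_mono order_trans)
qed

text \<open>
  Cauchy-Schwarz against 1 gives \<open>\<bar>t x\<bar>\<^sup>2 \<le> t 1 * \<parallel>x\<parallel>\<^sup>2\<close>, so \<open>t 1 < 1\<close> would make the norm of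
  \<open>t\<close> smaller than 1.
\<close>

lemma state_one:
  fixes t :: "'a::cstar_algebra_1 \<Rightarrow>\<^sub>L complex"
  assumes t: "state t"
  shows "t 1 = 1"
proof -
  have "t (star 1 * 1) \<in> \<real>\<^sub>\<ge>\<^sub>0"
    using t unfolding state_def positive_functional_def by blast
  then have im: "Im (t 1) = 0" and re: "0 \<le> Re (t 1)"
    by (simp_all add: star_one complex_nonneg_Reals_iff)
  have "norm t \<le> sqrt (Re (t 1))"
  proof (rule norm_blinfun_bound)
    fix x
    have "(cmod (t x))\<^sup>2 \<le> Re (t 1) * (norm x)\<^sup>2"
      using state_mult_le[OF t, of 1 x] by (simp add: star_one)
    from real_sqrt_le_mono[OF this] show "norm (t x) \<le> sqrt (Re (t 1)) * norm x"
      by (simp add: real_sqrt_mult)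
  qed (use re in simp)
  then have "1 \<le> Re (t 1)" using t by (simp add: state_def)
  moreover have "Re (t 1) \<le> 1"
    using state_norm_le[OF t, of 1] complex_Re_le_cmod[of "t 1"] by simp
  ultimately show ?thesis using im by (simp add: complex_eq_iff)
qed

text \<open>
  Expanding \<open>(b - 1/2)\<^sup>2 = b\<^sup>2 - b + 1/4\<close>, whose norm is at most \<open>1/4\<close>, gives this without
  any square root of the positive element \<open>b - b\<^sup>2\<close>.
\<close>

lemma state_square_le:
  fixes b :: "'a::cstar_algebra_1"
  assumes t: "state t" and b: "cstar_le 0 b" "cstar_le b 1"
  shows "Re (t (b * b)) \<le> Re (t b)"
proof -
  define h where "h = b - (1/2) *\<^sub>R (1::'a)"
  have "norm h \<le> 1/2"
    unfolding h_def by (rule norm_positive_contraction_minus_half[OF b])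
  then have "norm h * norm h \<le> (1/2) * (1/2)" by (intro mult_mono) auto
  then have "Re (t (h * h)) \<le> 1/4"
    using norm_mult_ineq[of h h] state_norm_le[OF t, of "h * h"] complex_Re_le_cmod[of "t (h * h)"]
    by linarith
  moreover have "h * h = b * b - b + (1/4) *\<^sub>R 1"
    by (simp add: h_def algebra_simps flip: scaleR_add_left)
  ultimately show ?thesis
    using state_one[OF t]
    by (simp add: blinfun.add_right blinfun.diff_right blinfun.scaleR_right)
qed

lemma norm_prod_list_le_one:
  fixes w :: "'a::real_normed_algebra_1 list"
  assumes "\<And>b. b \<in> set w \<Longrightarrow> norm b \<le> 1"
  shows "norm (prod_list w) \<le> 1"
  using assms
proof (induction w)
  case (Cons b w)
  then have "norm b * norm (prod_list w) \<le> 1 * 1" by (intro mult_mono) auto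
  then show ?case using norm_mult_ineq[of b "prod_list w"] by simp
qed simp

text \<open>
  The first factor \<open>b\<close> alone already gives the bound: \<open>\<bar>t (b * y)\<bar>\<^sup>2 \<le> t (b\<^sup>2) * \<parallel>y\<parallel>\<^sup>2 \<le> t b\<close>, where the product
  \<open>y\<close> of the other factors is a contraction.
\<close>

lemma state_prod_list_le:
  fixes w :: "'a::cstar_algebra_1 list"
  assumes t: "state t" and "w \<noteq> []"
    and w: "\<And>b. b \<in> set w \<Longrightarrow> cstar_le 0 b \<and> cstar_le b 1 \<and> cmod (t b) \<le> \<eta>"
  shows "cmod (t (prod_list w)) \<le> sqrt \<eta>"
proof -
  obtain b v where wv: "w = b # v" using \<open>w \<noteq> []\<close> by (cases w) auto
  have b: "cstar_le 0 b" "cstar_le b 1" "cmod (t b) \<le> \<eta>" using w[of b] wv by auto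
  have sa: "star b = b" using b by (simp add: cstar_le_def positive_def)
  have "norm (prod_list v) \<le> 1"
    using w wv by (intro norm_prod_list_le_one norm_positive_contraction) auto
  then have n: "(norm (prod_list v))\<^sup>2 \<le> 1" by (simp add: power_le_one)
  have "t (star b * b) \<in> \<real>\<^sub>\<ge>\<^sub>0"
    using t unfolding state_def positive_functional_def by blast
  then have p: "0 \<le> Re (t (b * b))" by (simp add: sa complex_nonneg_Reals_iff)
  have "(cmod (t (b * prod_list v)))\<^sup>2 \<le> Re (t (b * b)) * (norm (prod_list v))\<^sup>2"
    using state_mult_le[OF t, of b "prod_list v"] by (simp add: sa)
  also have "\<dots> \<le> Re (t (b * b))" using mult_left_mono[OF n p] by simp
  also have "\<dots> \<le> \<eta>"
    using state_square_le[OF t b(1,2)] complex_Re_le_cmod[of "t b"] b(3) by linarith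
  finally show ?thesis by (simp add: wv real_le_rsqrt)
qed

section \<open>Uncountability and almost irredundance\<close>

lemma uncountable_omega1:
  includes cardinal_syntax
  shows "uncountable omega1"
proof
  assume "countable omega1"
  then obtain f :: "nat set \<Rightarrow> nat" where "inj_on f omega1" by (rule countableE)
  then have "|omega1| \<le>o |UNIV :: nat set|" by (intro card_of_ordLeqI) auto
  then have "|omega1| \<le>o natLeq" using card_of_nat ordLeq_ordIso_trans by blast
  moreover have "|omega1| =o cardSuc natLeq"
    unfolding omega1_def by (intro card_of_Field_ordIso cardSuc_Card_order natLeq_Card_order)
  ultimately have "cardSuc natLeq \<le>o natLeq"
    using ordIso_ordLeq_trans ordIso_symmetric by blast
  then show False
    using cardSuc_greater[OF natLeq_Card_order] not_ordLess_ordLeq by blast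
qed

lemma UBABS_plus_inj_on:
  assumes "\<eta> < 1" and "UBABS_plus \<eta> a t"
  shows "inj_on a omega1"
proof (rule inj_onI, rule ccontr)
  fix \<alpha> \<beta> assume "\<alpha> \<in> omega1" "\<beta> \<in> omega1" "a \<alpha> = a \<beta>" "\<alpha> \<noteq> \<beta>"
  then have "t \<alpha> (a \<beta>) = 1" "cmod (t \<alpha> (a \<beta>)) \<le> \<eta>"
    using assms(2) unfolding UBABS_plus_def by (metis, blast)
  then show False using \<open>\<eta> < 1\<close> by simp
qed

theorem theorem1p5:
  fixes a :: "nat set \<Rightarrow> 'a::cstar_algebra_1"
    and \<tau> :: "nat set \<Rightarrow> 'a \<Rightarrow>\<^sub>L complex"
    and \<eta> :: real
  assumes "0 \<le> \<eta>" and "\<eta> < 1"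
    and "UBABS_plus \<eta> a \<tau>"
  shows "uncountable (a ` omega1) \<and> almost_irredundant (a ` omega1)"
proof
  show "uncountable (a ` omega1)"
    using uncountable_omega1 UBABS_plus_inj_on[OF assms(2,3)] countable_image_inj_on by blast
  show "almost_irredundant (a ` omega1)"
    unfolding almost_irredundant_def
  proof (rule ballI, rule notI)
    fix x
    let ?S = "{(\<Sum>i<n. l i *\<^sub>C prod_list (w i)) | (n::nat) (l::nat \<Rightarrow> complex) (w::nat \<Rightarrow> 'a list).
       n \<ge> 1 \<and> (\<forall>i<n. w i \<noteq> [] \<and> set (w i) \<subseteq> a ` omega1 - {x}) \<and> (\<Sum>i<n. cmod (l i)) \<le> 1}"
    assume "x \<in> a ` omega1" and cl: "x \<in> closure ?S"
    then obtain \<alpha> where \<alpha>: "\<alpha> \<in> omega1" and x: "x = a \<alpha>" by blast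
    define t where "t = \<tau> \<alpha>"
    have t: "state t" and tx: "t x = 1"
      and t_off: "\<And>\<beta>. \<beta> \<in> omega1 \<Longrightarrow> \<beta> \<noteq> \<alpha> \<Longrightarrow> cmod (t (a \<beta>)) \<le> \<eta>"
      using assms(3) \<alpha> by (auto simp: UBABS_plus_def t_def x)
    have contr: "cstar_le 0 (a \<beta>) \<and> cstar_le (a \<beta>) 1" if "\<beta> \<in> omega1" for \<beta>
      using assms(3) that by (auto simp: UBABS_plus_def cstar_less_def)
    have hom: "t (c *\<^sub>C u) = c * t u" for c u
      using t by (simp add: state_def positive_functional_def dual_space_def)
    have "?S \<subseteq> {y. cmod (t y) \<le> sqrt \<eta>}"
    proof clarify
      fix n l and w :: "nat \<Rightarrow> 'a list"
      assume w: "\<forall>i<n. w i \<noteq> [] \<and> set (w i) \<subseteq> a ` omega1 - {x}"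
        and l: "(\<Sum>i<n. cmod (l i)) \<le> 1"
      have prod: "cmod (t (prod_list (w i))) \<le> sqrt \<eta>" if "i < n" for i
      proof (rule state_prod_list_le[OF t])
        show "w i \<noteq> []" using w that by blast
        fix b assume "b \<in> set (w i)"
        with w that have "b \<in> a ` omega1 - {x}" by blast
        then obtain \<beta> where "\<beta> \<in> omega1" "b = a \<beta>" "b \<noteq> x" by blast
        then show "cstar_le 0 b \<and> cstar_le b 1 \<and> cmod (t b) \<le> \<eta>"
          using contr t_off x by blast
      qed
      have "cmod (t (\<Sum>i<n. l i *\<^sub>C prod_list (w i))) \<le> (\<Sum>i<n. cmod (l i) * cmod (t (prod_list (w i))))"
        by (simp add: blinfun.sum_right hom norm_mult[symmetric] norm_sum)
      also have "\<dots> \<le> (\<Sum>i<n. cmod (l i) * sqrt \<eta>)"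
        using prod by (intro sum_mono mult_left_mono) auto
      also have "\<dots> \<le> sqrt \<eta>"
        using mult_right_mono[OF l, of "sqrt \<eta>"] assms(1) by (simp add: sum_distrib_right)
      finally show "cmod (t (\<Sum>i<n. l i *\<^sub>C prod_list (w i))) \<le> sqrt \<eta>" .
    qed
    moreover have "closed {y. cmod (t y) \<le> sqrt \<eta>}"
      by (intro closed_Collect_le continuous_intros)
    ultimately have "cmod (t x) \<le> sqrt \<eta>"
      using closure_minimal cl by blast
    moreover have "sqrt \<eta> < 1" using assms(2) real_sqrt_lt_1_iff by blast
    ultimately show False using tx by simp
  qed
qed

end
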